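(* Let $(\mathcal{X}, \mathcal{S})$ be a measurable space, let $\mathcal{C} \subseteq \mathcal{S}$ be a separable VC-class of sets, and let $\mathbf{X} = X_1, X_2, \ldots$ be a stationary ergodic process taking values in $(\mathcal{X}, \mathcal{S})$. Then $$\Delta_n(\mathcal{C} : \mathbf{X}) = \sup_{C \in \mathcal{C}} \left| \frac{1}{n} \sum_{i=1}^n I_C(X_i) - P(X \in C) \right| \to 0$$ almost surely as $n$ tends to infinity.
   Context: Here $I_C$ is the indicator function of $C$, and $P(X \in C)$ denotes the probability of $C$ under the common marginal distribution of the $X_i$ (i.e. $P(X_1 \in C)$). VC-class: a family $\mathcal{C}$ of subsets of $\mathcal{X}$ shatters a finite set $D \subseteq \mathcal{X}$ if $|\{C \cap D : C \in \mathcal{C}\}| = 2^{|D|}$. The VC dimension $\dim(\mathcal{C})$ is the largest integer $k$ such that $\mathcal{C}$ shatters some set of cardinality $k$ ($+\infty$ if $\mathcal{C}$ shatters arbitrarily large finite sets). $\mathcal{C}$ is a VC-class if $\dim(\mathcal{C}) < \infty$. Separability: $\mathcal{C}$ is separable if there is a countable sub-family $\mathcal{C}_0 \subseteq \mathcal{C}$ such that for each $C \in \mathcal{C}$ the indicator function $I_C$ is a pointwise limit (on all of $\mathcal{X}$) of a sequence of indicator functions of sets in $\mathcal{C}_0$. *)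

theory Defs
  imports "HOL-Probability.Probability"
begin

definition shatters :: "'a set set \<Rightarrow> 'a set \<Rightarrow> bool" where
  "shatters \<C> D \<longleftrightarrow> finite D \<and> card ((\<lambda>C. C \<inter> D) ` \<C>) = 2 ^ card D"

text \<open>The values \<open>card D\<close> below form an initial segment of the natural numbers, so the supremum
  in \<^typ>\<open>enat\<close> is their maximum if there are finitely many of them, and \<open>\<infinity>\<close> otherwise.\<close>

definition vc_dim :: "'a set \<Rightarrow> 'a set set \<Rightarrow> enat" where
  "vc_dim \<X> \<C> = (SUP D \<in> {D. D \<subseteq> \<X> \<and> shatters \<C> D}. enat (card D))"

definition vc_class :: "'a set \<Rightarrow> 'a set set \<Rightarrow> bool" where
  "vc_class \<X> \<C> \<longleftrightarrow> \<C> \<subseteq> Pow \<X> \<and> vc_dim \<X> \<C> < \<infinity>"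

definition separable_class :: "'a set \<Rightarrow> 'a set set \<Rightarrow> bool" where
  "separable_class \<X> \<C> \<longleftrightarrow>
    (\<exists>\<C>\<^sub>0. \<C>\<^sub>0 \<subseteq> \<C> \<and> countable \<C>\<^sub>0 \<and>
      (\<forall>C\<in>\<C>. \<exists>A :: nat \<Rightarrow> 'a set. range A \<subseteq> \<C>\<^sub>0 \<and>
        (\<forall>x\<in>\<X>. (\<lambda>k. indicator (A k) x :: real) \<longlonglongrightarrow> indicator C x)))"

text \<open>Processes are indexed from 0: the variable usually written \<open>X\<^sub>1\<close> is \<open>X 0\<close>.\<close>

definition path_space :: "'a measure \<Rightarrow> (nat \<Rightarrow> 'a) measure" where
  "path_space S = (\<Pi>\<^sub>M i\<in>UNIV. S)"

definition path_law :: "'w measure \<Rightarrow> 'a measure \<Rightarrow> (nat \<Rightarrow> 'w \<Rightarrow> 'a) \<Rightarrow> (nat \<Rightarrow> 'a) measure" where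
  "path_law M S X = distr M (path_space S) (\<lambda>\<omega> i. X i \<omega>)"

definition shift :: "(nat \<Rightarrow> 'a) \<Rightarrow> nat \<Rightarrow> 'a" where
  "shift x = (\<lambda>i. x (Suc i))"

definition stationary_process :: "'w measure \<Rightarrow> 'a measure \<Rightarrow> (nat \<Rightarrow> 'w \<Rightarrow> 'a) \<Rightarrow> bool" where
  "stationary_process M S X \<longleftrightarrow>
    (\<forall>i. X i \<in> M \<rightarrow>\<^sub>M S) \<and> path_law M S (\<lambda>i. X (Suc i)) = path_law M S X"

definition ergodic_process :: "'w measure \<Rightarrow> 'a measure \<Rightarrow> (nat \<Rightarrow> 'w \<Rightarrow> 'a) \<Rightarrow> bool" where
  "ergodic_process M S X \<longleftrightarrow>
    (\<forall>A \<in> sets (path_space S). shift -` A \<inter> space (path_space S) = A \<longrightarrow>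
      measure (path_law M S X) A = 0 \<or> measure (path_law M S X) A = 1)"

text \<open>The deviations are at most 1; taking the supremum in \<^typ>\<open>ennreal\<close> makes it 0 over the
  empty class, where the supremum in \<^typ>\<open>real\<close> is unspecified.\<close>

definition uniform_deviation ::
  "'w measure \<Rightarrow> (nat \<Rightarrow> 'w \<Rightarrow> 'a) \<Rightarrow> 'a set set \<Rightarrow> nat \<Rightarrow> 'w \<Rightarrow> ennreal" where
  "uniform_deviation M X \<C> n \<omega> =
    (SUP C\<in>\<C>. ennreal \<bar>(1 / real n) * (\<Sum>i<n. indicator C (X i \<omega>)) - \<P>(\<omega>' in M. X 0 \<omega>' \<in> C)\<bar>)"

end

theory Submission
  imports Defs
begin

text \<open>A VC-class has finite bracketing covers under every probability measure \<open>\<mu>\<close>: given \<open>e > 0\<close> there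
  is a finite partition such that, for each \<open>C\<close> in the class, the union of the cells that \<open>C\<close> cuts into
  two pieces of positive measure (the boundary of \<open>C\<close>) has measure at most \<open>e\<close>. Otherwise one shrinks
  the class and refines the partition, nearly minimizing the measure of the union of all boundaries;
  in the limit there remains a set \<open>D\<close> of measure at least \<open>e\<close> such that any finitely many subsets
  of \<open>D\<close> of positive measure are cut simultaneously by one member of the class. Cutting repeatedly
  yields arbitrarily long independent sequences in the class, so its VC dimension is infinite.
  Birkhoff's ergodic theorem for the finitely many brackets then gives uniform convergence over a
  countable separating subfamily, and separability carries it over to the whole class. The argument
  follows Adams and Nobel.\<close>

section \<open>Birkhoff's pointwise ergodic theorem\<close>

definition birkhoff_sum :: "('a \<Rightarrow> 'a) \<Rightarrow> ('a \<Rightarrow> real) \<Rightarrow> nat \<Rightarrow> 'a \<Rightarrow> real" where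
  "birkhoff_sum T g n x = (\<Sum>i<n. g ((T ^^ i) x))"

lemma birkhoff_sum_0 [simp]: "birkhoff_sum T g 0 x = 0"
  by (simp add: birkhoff_sum_def)

lemma birkhoff_sum_Suc: "birkhoff_sum T g (Suc n) x = g x + birkhoff_sum T g n (T x)"
  unfolding birkhoff_sum_def by (simp add: sum.lessThan_Suc_shift funpow_swap1 del: sum.lessThan_Suc)

text \<open>The maximum of \<open>birkhoff_sum T g k x\<close> over \<open>k\<close> from 0 to
  \<open>n\<close>, unfolded along the orbit. The recursion through \<open>T x\<close> is the form
  that the maximal inequality uses, and it makes integrability an induction on
  \<open>n\<close>.\<close>

fun maximal_sum :: "('a \<Rightarrow> 'a) \<Rightarrow> ('a \<Rightarrow> real) \<Rightarrow> nat \<Rightarrow> 'a \<Rightarrow> real" where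
  "maximal_sum T g 0 x = 0"
| "maximal_sum T g (Suc n) x = max 0 (g x + maximal_sum T g n (T x))"

lemma maximal_sum_nonneg: "0 \<le> maximal_sum T g n x"
  by (cases n) auto

lemma maximal_sum_le_Suc: "maximal_sum T g n x \<le> maximal_sum T g (Suc n) x"
proof (induction n arbitrary: x)
  case (Suc n)
  have "maximal_sum T g n (T x) \<le> maximal_sum T g (Suc n) (T x)" by (rule Suc.IH)
  then show ?case
    unfolding maximal_sum.simps(2)[of T g _ x] by (intro max.mono add_left_mono order_refl)
qed simp

lemma maximal_sum_mono: "m \<le> n \<Longrightarrow> maximal_sum T g m x \<le> maximal_sum T g n x"
  by (rule lift_Suc_mono_le[of "\<lambda>n. maximal_sum T g n x"]) (rule maximal_sum_le_Suc)

lemma birkhoff_sum_le_maximal_sum: "birkhoff_sum T g n x \<le> maximal_sum T g n x"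
proof (induction n arbitrary: x)
  case (Suc n)
  have "birkhoff_sum T g n (T x) \<le> maximal_sum T g n (T x)" by (rule Suc.IH)
  then show ?case by (simp add: birkhoff_sum_Suc)
qed simp

text \<open>Invariance of \<open>A\<close> means exact equality with its preimage, as in
  \<open>ergodic_process\<close>. A set to which ergodicity is applied must therefore be invariant
  pointwise, not merely up to a null set.\<close>

locale ergodic_map = prob_space P for P :: "'a measure" +
  fixes T :: "'a \<Rightarrow> 'a"
  assumes measurable_T [measurable]: "T \<in> P \<rightarrow>\<^sub>M P"
    and distr_T: "distr P P T = P"
    and ergodic: "\<And>A. A \<in> sets P \<Longrightarrow> T -` A \<inter> space P = A \<Longrightarrow> prob A = 0 \<or> prob A = 1"
begin

lemma measurable_funpow_T [measurable]: "T ^^ i \<in> P \<rightarrow>\<^sub>M P"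
  by (induction i) (auto simp: id_def intro: measurable_comp[OF _ measurable_T])

lemma measurable_birkhoff_sum [measurable]:
  assumes [measurable]: "g \<in> borel_measurable P"
  shows "birkhoff_sum T g n \<in> borel_measurable P"
  unfolding birkhoff_sum_def by measurable

lemma integrable_T:
  fixes h :: "'a \<Rightarrow> real"
  assumes "integrable P h"
  shows "integrable P (\<lambda>x. h (T x))"
  using assms integrable_distr[OF measurable_T, of h] by (simp add: distr_T)

lemma integral_T:
  fixes h :: "'a \<Rightarrow> real"
  assumes "integrable P h"
  shows "(\<integral>x. h (T x) \<partial>P) = (\<integral>x. h x \<partial>P)"
proof -
  have "h \<in> borel_measurable P" using assms by auto
  from integral_distr[OF measurable_T this] show ?thesis by (simp add: distr_T)
qed

lemma integrable_maximal_sum: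
  assumes "integrable P g"
  shows "integrable P (maximal_sum T g n)"
proof (induction n)
  case (Suc n)
  have "integrable P (\<lambda>x. max 0 (g x + maximal_sum T g n (T x)))"
    using assms integrable_T[OF Suc] by (intro integrable_max) auto
  then show ?case by (simp cong: integrable_cong)
qed (simp add: maximal_sum.simps(1)[abs_def])

text \<open>Garsia's argument: where \<open>maximal_sum\<close> is positive, it exceeds its own shift by at most \<open>g\<close>, and
  the difference to the shift integrates to zero.\<close>

lemma maximal_ergodic:
  assumes g: "integrable P g"
  shows "0 \<le> (\<integral>x. g x * indicator {x. 0 < maximal_sum T g (Suc n) x} x \<partial>P)"
proof -
  let ?m = "maximal_sum T g (Suc n)"
  have m: "integrable P ?m" by (rule integrable_maximal_sum[OF g])
  have [measurable]: "?m \<in> borel_measurable P" using m by (rule borel_measurable_integrable)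
  have [measurable]: "g \<in> borel_measurable P" using g by (rule borel_measurable_integrable)
  have "0 = (\<integral>x. ?m x - ?m (T x) \<partial>P)"
    using m integrable_T[OF m] integral_T[OF m] by (subst Bochner_Integration.integral_diff) (auto simp del: maximal_sum.simps)
  also have "\<dots> \<le> (\<integral>x. g x * indicator {x. 0 < ?m x} x \<partial>P)"
  proof (rule integral_mono)
    show "integrable P (\<lambda>x. ?m x - ?m (T x))"
      using m integrable_T[OF m] by (rule Bochner_Integration.integrable_diff)
    show "integrable P (\<lambda>x. g x * indicator {x. 0 < ?m x} x)"
      by (rule Bochner_Integration.integrable_bound[OF g]) (auto simp: indicator_def simp del: maximal_sum.simps)
    fix x
    show "?m x - ?m (T x) \<le> g x * indicator {x. 0 < ?m x} x"
    proof (cases "0 < ?m x")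
      case True
      then have "?m x = g x + maximal_sum T g n (T x)" by simp
      also have "\<dots> \<le> g x + ?m (T x)"
        using maximal_sum_le_Suc[of T g n "T x"] by linarith
      finally show ?thesis using True by (simp del: maximal_sum.simps)
    next
      case False
      then show ?thesis using maximal_sum_nonneg[of T g "Suc n" "T x"]
        by (simp del: maximal_sum.simps)
    qed
  qed
  finally show ?thesis .
qed

text \<open>The set \<open>E\<close> where the sums are unbounded above is invariant, because
  passing from \<open>x\<close> to \<open>T x\<close> drops one term and subtracts a constant. If
  \<open>E\<close> had probability 1, the events on which the maximal sums are positive would
  exhaust the space up to a null set, and the maximal inequality would give a nonnegative integral
  in the limit. So \<open>E\<close> is null by ergodicity.\<close>

lemma AE_birkhoff_sum_bounded:
  assumes g: "integrable P g" and neg: "(\<integral>x. g x \<partial>P) < 0"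
  shows "AE x in P. \<exists>K. \<forall>n. birkhoff_sum T g n x \<le> K"
proof -
  have [measurable]: "g \<in> borel_measurable P" using g by (rule borel_measurable_integrable)
  \<comment> \<open>Thresholds in \<open>nat\<close> exhibit \<open>E\<close> as a countable
    combination of measurable sets; \<open>unb_iff\<close> returns to real thresholds for the
    invariance.\<close>
  define E where "E = {x \<in> space P. \<forall>k::nat. \<exists>n. real k < birkhoff_sum T g n x}"
  have E [measurable]: "E \<in> sets P" unfolding E_def by measurable
  have unb_iff: "(\<forall>k::nat. \<exists>n. real k < h n) \<longleftrightarrow> (\<forall>K. \<exists>n. K < h n)" for h :: "nat \<Rightarrow> real"
    by (meson less_trans reals_Archimedean2)
  have unb_Suc: "(\<forall>K. \<exists>n. K < h n) \<longleftrightarrow> (\<forall>K. \<exists>n. K < h (Suc n))" for h :: "nat \<Rightarrow> real"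
  proof
    assume *: "\<forall>K. \<exists>n. K < h n"
    show "\<forall>K. \<exists>n. K < h (Suc n)"
    proof
      fix K
      \<comment> \<open>Including \<open>h 0\<close> in the threshold excludes the index 0, so
        \<open>n\<close> is a successor.\<close>
      obtain n where n: "max K (h 0) < h n" using * by blast
      then have "n \<noteq> 0" by (intro notI) simp
      then show "\<exists>n. K < h (Suc n)" using n by (metis max_less_iff_conj not0_implies_Suc)
    qed
  qed blast
  have unb_add: "(\<forall>K. \<exists>n. K < c + h n) \<longleftrightarrow> (\<forall>K. \<exists>n. K < h n)" for c and h :: "nat \<Rightarrow> real"
    by (metis add.commute diff_less_eq add_diff_cancel_left')
  have inv: "T -` E \<inter> space P = E"
  proof -
    have "(\<forall>K. \<exists>n. K < birkhoff_sum T g n x) \<longleftrightarrow> (\<forall>K. \<exists>n. K < birkhoff_sum T g n (T x))" for x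
      using unb_Suc[of "\<lambda>n. birkhoff_sum T g n x"]
      by (simp only: birkhoff_sum_Suc unb_add)
    then show ?thesis
      using measurable_space[OF measurable_T] by (auto simp: E_def unb_iff)
  qed
  have "prob E \<noteq> 1"
  proof
    assume "prob E = 1"
    then have AE_E: "AE x in P. x \<in> E" using prob_eq_1[OF E] by simp
    have "(\<lambda>n. \<integral>x. g x * indicator {x. 0 < maximal_sum T g (Suc n) x} x \<partial>P)
        \<longlonglongrightarrow> (\<integral>x. g x \<partial>P)"
    proof (rule integral_dominated_convergence[where w="\<lambda>x. \<bar>g x\<bar>"])
      fix n
      have [measurable]: "maximal_sum T g (Suc n) \<in> borel_measurable P"
        using integrable_maximal_sum[OF g] by (rule borel_measurable_integrable)
      show "(\<lambda>x. g x * indicator {x. 0 < maximal_sum T g (Suc n) x} x) \<in> borel_measurable P"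
        by measurable
      show "AE x in P. norm (g x * indicator {x. 0 < maximal_sum T g (Suc n) x} x) \<le> \<bar>g x\<bar>"
        by (simp add: indicator_def del: maximal_sum.simps)
    next
      show "AE x in P. (\<lambda>n. g x * indicator {x. 0 < maximal_sum T g (Suc n) x} x) \<longlonglongrightarrow> g x"
        using AE_E
      proof eventually_elim
        case (elim x)
        then have "\<exists>n. real 0 < birkhoff_sum T g n x" unfolding E_def by blast
        then obtain n where "0 < birkhoff_sum T g n x" by auto
        then have n: "0 < maximal_sum T g n x"
          using birkhoff_sum_le_maximal_sum[of T g n x] by linarith
        have pos: "0 < maximal_sum T g (Suc k) x" if "n \<le> k" for k
        proof -
          have "maximal_sum T g n x \<le> maximal_sum T g (Suc k) x"
            using that by (intro maximal_sum_mono) simp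
          with n show ?thesis by linarith
        qed
        show ?case
        proof (rule tendsto_eventually)
          show "\<forall>\<^sub>F k in sequentially. g x * indicator {x. 0 < maximal_sum T g (Suc k) x} x = g x"
            using eventually_ge_at_top[of n]
            by eventually_elim (simp add: pos del: maximal_sum.simps)
        qed
      qed
    qed (use g in auto)
    then have "0 \<le> (\<integral>x. g x \<partial>P)"
      by (rule LIMSEQ_le_const) (use maximal_ergodic[OF g] in blast)
    with neg show False by simp
  qed
  then have "prob E = 0" using ergodic[OF E inv] by blast
  then have "AE x in P. x \<notin> E" using E
    by (metis AE_iff_null_sets emeasure_eq_measure ennreal_0 null_setsI)
  with AE_space show ?thesis
  proof eventually_elim
    case (elim x)
    then show ?case unfolding E_def by (auto simp: not_less)
  qed
qed

text \<open>Both \<open>f - m - 1 / Suc j\<close> and \<open>m - f - 1 / Suc j\<close> have negative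
  integral, so their sums are bounded above almost surely. Dividing by \<open>n\<close> confines the
  averages of \<open>f\<close> to within \<open>1 / Suc j\<close> of \<open>m\<close> in the limit,
  for countably many \<open>j\<close> at once.\<close>

theorem birkhoff:
  assumes f: "integrable P f"
  shows "AE x in P. (\<lambda>n. birkhoff_sum T f n x / n) \<longlonglongrightarrow> (\<integral>x. f x \<partial>P)"
proof -
  define m where "m = (\<integral>x. f x \<partial>P)"
  have "AE x in P. \<forall>j::nat. (\<exists>K. \<forall>n. birkhoff_sum T (\<lambda>x. f x - m - 1 / Suc j) n x \<le> K) \<and>
      (\<exists>K. \<forall>n. birkhoff_sum T (\<lambda>x. m - f x - 1 / Suc j) n x \<le> K)"
    unfolding AE_all_countable AE_conj_iff
  proof
    fix j :: nat
    have 1: "AE x in P. \<exists>K. \<forall>n. birkhoff_sum T (\<lambda>x. f x - m - 1 / Suc j) n x \<le> K"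
      by (rule AE_birkhoff_sum_bounded) (use f in \<open>auto simp: m_def prob_space\<close>)
    have 2: "AE x in P. \<exists>K. \<forall>n. birkhoff_sum T (\<lambda>x. m - f x - 1 / Suc j) n x \<le> K"
      by (rule AE_birkhoff_sum_bounded) (use f in \<open>auto simp: m_def prob_space\<close>)
    show "(AE x in P. \<exists>K. \<forall>n. birkhoff_sum T (\<lambda>x. f x - m - 1 / Suc j) n x \<le> K) \<and>
      (AE x in P. \<exists>K. \<forall>n. birkhoff_sum T (\<lambda>x. m - f x - 1 / Suc j) n x \<le> K)"
      using 1 2 by blast
  qed
  then show ?thesis
  proof eventually_elim
    case (elim x)
    show ?case
    proof (rule LIMSEQ_I)
      fix r :: real assume "0 < r"
      then obtain j :: nat where j: "1 / Suc j < r / 2"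
        using reals_Archimedean[of "r / 2"] by (auto simp: inverse_eq_divide)
      obtain K where K: "\<And>n. birkhoff_sum T (\<lambda>x. f x - m - 1 / Suc j) n x \<le> K"
        using elim by blast
      obtain L where L: "\<And>n. birkhoff_sum T (\<lambda>x. m - f x - 1 / Suc j) n x \<le> L"
        using elim by blast
      have up: "birkhoff_sum T f n x - n * m \<le> K + n * (1 / Suc j)" for n
        using K[of n] by (simp add: birkhoff_sum_def sum_subtractf sum.distrib algebra_simps)
      have lo: "n * m - birkhoff_sum T f n x \<le> L + n * (1 / Suc j)" for n
        using L[of n] by (simp add: birkhoff_sum_def sum_subtractf sum.distrib algebra_simps)
      define B where "B = max K L"
      \<comment> \<open>Beyond \<open>N\<close> the bounded part contributes less than
        \<open>r / 2\<close> to the average; the other half of \<open>r\<close> is left for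
        \<open>1 / Suc j\<close>. Starting at \<open>Suc N\<close> makes \<open>n\<close>
        positive.\<close>
      obtain N :: nat where N: "2 * B / r < real N" using reals_Archimedean2 by blast
      show "\<exists>no. \<forall>n\<ge>no. norm (birkhoff_sum T f n x / n - (\<integral>x. f x \<partial>P)) < r"
      proof (intro exI[of _ "Suc N"] allI impI)
        fix n assume n: "Suc N \<le> n"
        then have n0: "0 < real n" by simp
        have "2 * B / r < real n" using N n by linarith
        then have B_less: "B < n * (r / 2)" using \<open>0 < r\<close> by (simp add: field_simps)
        have "n * (1 / Suc j) \<le> n * (r / 2)" using j n0 by (intro mult_left_mono) auto
        moreover have "\<bar>birkhoff_sum T f n x - n * m\<bar> \<le> B + n * (1 / Suc j)"
          using up[of n] lo[of n] unfolding B_def by linarith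
        ultimately have "\<bar>birkhoff_sum T f n x - n * m\<bar> < n * (r / 2) + n * (r / 2)"
          using B_less by linarith
        then have "\<bar>birkhoff_sum T f n x - n * m\<bar> < n * r" by (simp add: mult.commute)
        then have "\<bar>birkhoff_sum T f n x - n * m\<bar> / n < r"
          using n0 by (simp add: field_simps)
        moreover have "birkhoff_sum T f n x / n - m = (birkhoff_sum T f n x - n * m) / n"
          using n0 by (simp add: field_simps)
        ultimately show "norm (birkhoff_sum T f n x / n - (\<integral>x. f x \<partial>P)) < r"
          using n0 by (simp add: m_def[symmetric])
      qed
    qed
  qed
qed

end

section \<open>Finite partitions and the boundaries of sets\<close>

definition cuts :: "'a measure \<Rightarrow> 'a set \<Rightarrow> 'a set \<Rightarrow> bool" where
  "cuts M C A \<longleftrightarrow> 0 < measure M (A \<inter> C) \<and> 0 < measure M (A - C)"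

text \<open>The atom containing \<open>x\<close> of the algebra generated by \<open>G\<close>.
  Describing a partition by a generating family turns refinement into inclusion of families.\<close>

definition cell :: "'a measure \<Rightarrow> 'a set set \<Rightarrow> 'a \<Rightarrow> 'a set" where
  "cell M G x = {y \<in> space M. \<forall>B\<in>G. y \<in> B \<longleftrightarrow> x \<in> B}"

definition boundary :: "'a measure \<Rightarrow> 'a set set \<Rightarrow> 'a set \<Rightarrow> 'a set" where
  "boundary M G C = {x \<in> space M. cuts M C (cell M G x)}"

text \<open>The content is uniformity: one finite \<open>G\<close> must serve the whole class. For a
  single \<open>C\<close> the family consisting of \<open>C\<close> alone already has empty
  boundary.\<close>

definition thin :: "'a measure \<Rightarrow> real \<Rightarrow> 'a set set \<Rightarrow> bool" where
  "thin M e \<F> \<longleftrightarrow>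
    (\<exists>G. finite G \<and> G \<subseteq> sets M \<and> (\<forall>C\<in>\<F>. measure M (boundary M G C) \<le> e))"

lemma cell_refl: "x \<in> space M \<Longrightarrow> x \<in> cell M G x"
  by (simp add: cell_def)

lemma cell_eq: "y \<in> cell M G x \<Longrightarrow> cell M G y = cell M G x"
  by (auto simp: cell_def)

lemma cell_antimono: "G \<subseteq> H \<Longrightarrow> cell M H x \<subseteq> cell M G x"
  by (auto simp: cell_def)

lemma finite_cells:
  assumes "finite G"
  shows "finite (cell M G ` space M)"
proof (rule finite_subset)
  show "cell M G ` space M \<subseteq> (\<lambda>T. {y \<in> space M. \<forall>B\<in>G. y \<in> B \<longleftrightarrow> B \<in> T}) ` Pow G"
  proof
    fix A assume "A \<in> cell M G ` space M"
    then obtain x where "A = cell M G x" by blast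
    then have "A = {y \<in> space M. \<forall>B\<in>G. y \<in> B \<longleftrightarrow> B \<in> {B \<in> G. x \<in> B}}"
      by (auto simp: cell_def)
    then show "A \<in> (\<lambda>T. {y \<in> space M. \<forall>B\<in>G. y \<in> B \<longleftrightarrow> B \<in> T}) ` Pow G" by blast
  qed
qed (use assms in simp)

lemma sets_cell:
  assumes "finite G" "G \<subseteq> sets M"
  shows "cell M G x \<in> sets M"
  unfolding cell_def
proof (rule sets.sets_Collect_finite_All[OF _ assms(1)])
  fix B assume "B \<in> G"
  then have [measurable]: "B \<in> sets M" using assms by blast
  show "{y \<in> space M. y \<in> B \<longleftrightarrow> x \<in> B} \<in> sets M" by measurable
qed

lemma sets_Union_cells:
  assumes "finite G" "G \<subseteq> sets M" "\<A> \<subseteq> cell M G ` space M"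
  shows "\<Union>\<A> \<in> sets M"
proof (rule sets.finite_Union)
  show "finite \<A>" using finite_subset[OF assms(3) finite_cells[OF assms(1)]] .
  show "\<A> \<subseteq> sets M" using assms(3) sets_cell[OF assms(1,2)] by blast
qed

lemma boundary_eq_Union: "boundary M G C = \<Union>{A \<in> cell M G ` space M. cuts M C A}"
proof
  show "boundary M G C \<subseteq> \<Union>{A \<in> cell M G ` space M. cuts M C A}"
    by (auto simp: boundary_def intro: cell_refl)
  show "\<Union>{A \<in> cell M G ` space M. cuts M C A} \<subseteq> boundary M G C"
    using cell_eq[of _ M G] by (fastforce simp: boundary_def cell_def)
qed

lemma sets_boundary:
  assumes "finite G" "G \<subseteq> sets M"
  shows "boundary M G C \<in> sets M"
  unfolding boundary_eq_Union by (rule sets_Union_cells[OF assms]) auto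

text \<open>Every boundary is a union of some of the finitely many cells, so even an uncountable
  class has only finitely many boundaries. This makes unions of boundaries measurable and permits a
  pigeonhole argument.\<close>

lemma finite_boundaries: "finite G \<Longrightarrow> finite (boundary M G ` \<F>)"
proof (rule finite_subset)
  show "boundary M G ` \<F> \<subseteq> Union ` Pow (cell M G ` space M)"
    unfolding boundary_eq_Union by blast
qed (simp add: finite_cells)

lemma sets_UN_boundary:
  assumes "finite G" "G \<subseteq> sets M"
  shows "(\<Union>C\<in>\<F>. boundary M G C) \<in> sets M"
  using assms sets_boundary[OF assms] finite_boundaries[OF assms(1), of M \<F>]
  by (intro sets.finite_Union) auto

context prob_space
begin

lemma cuts_mono:
  assumes "cuts M C A" "A \<subseteq> B" "A \<in> events" "B \<in> events" "C \<in> events"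
  shows "cuts M C B"
proof -
  have "prob (A \<inter> C) \<le> prob (B \<inter> C)" "prob (A - C) \<le> prob (B - C)"
    using assms by (auto intro!: finite_measure_mono)
  with assms(1) show ?thesis unfolding cuts_def by linarith
qed

text \<open>A set that cuts a cell of the finer partition also cuts the coarser cell around
  it.\<close>

lemma boundary_antimono:
  assumes "G \<subseteq> H" "finite H" "H \<subseteq> events" "C \<in> events"
  shows "boundary M H C \<subseteq> boundary M G C"
proof -
  have "finite G" "G \<subseteq> events" using assms finite_subset by auto
  with assms show ?thesis
    unfolding boundary_def by (auto intro: cuts_mono[OF _ cell_antimono[OF assms(1)]] sets_cell)
qed

section \<open>Classes that are not thin\<close>

text \<open>A finite union of thin classes is thin: join their generating families, which only
  shrinks boundaries. Hence splitting a class that is not thin into finitely many pieces leaves a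
  piece that is not thin.\<close>

lemma not_thin_fiber:
  assumes "\<not> thin M e \<F>" "\<F> \<subseteq> events" "finite (h ` \<F>)"
  shows "\<exists>d. \<not> thin M e {C \<in> \<F>. h C = d}"
proof (rule ccontr)
  assume "\<nexists>d. \<not> thin M e {C \<in> \<F>. h C = d}"
  then have "\<forall>d. thin M e {C \<in> \<F>. h C = d}" by simp
  then have "\<forall>d. \<exists>G. finite G \<and> G \<subseteq> events \<and> (\<forall>C\<in>{C \<in> \<F>. h C = d}. prob (boundary M G C) \<le> e)"
    unfolding thin_def .
  from choice[OF this] obtain G where *: "\<forall>d. finite (G d) \<and> G d \<subseteq> events \<and>
      (\<forall>C\<in>{C \<in> \<F>. h C = d}. prob (boundary M (G d) C) \<le> e)" ..
  have G: "finite (G d)" "G d \<subseteq> events" for d using *[rule_format, of d] by simp_all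
  have le: "prob (boundary M (G d) C) \<le> e" if "C \<in> \<F>" "h C = d" for d C
    using *[rule_format, of d] that by simp
  define H where "H = (\<Union>d\<in>h ` \<F>. G d)"
  have "finite H" unfolding H_def by (rule finite_UN_I[OF assms(3) G(1)])
  moreover have "H \<subseteq> events" using G(2) by (auto simp: H_def)
  ultimately have H: "finite H" "H \<subseteq> events" .
  have "prob (boundary M H C) \<le> e" if C: "C \<in> \<F>" for C
  proof -
    have "G (h C) \<subseteq> H" using C by (auto simp: H_def)
    then have "boundary M H C \<subseteq> boundary M (G (h C)) C"
      by (rule boundary_antimono[OF _ H]) (use C assms(2) in blast)
    then have "prob (boundary M H C) \<le> prob (boundary M (G (h C)) C)"
      by (rule finite_measure_mono) (rule sets_boundary[OF G])
    with le[OF C refl] show ?thesis by linarith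
  qed
  with H have "thin M e \<F>" unfolding thin_def by blast
  with assms(1) show False by contradiction
qed

text \<open>Some single boundary already exceeds \<open>e\<close>. This lower bound later keeps a
  decreasing limit of such unions from being null.\<close>

lemma not_thin_boundary:
  assumes "\<not> thin M e \<F>" "finite G" "G \<subseteq> events"
  shows "e \<le> prob (\<Union>C\<in>\<F>. boundary M G C)"
proof -
  obtain C where C: "C \<in> \<F>" "e < prob (boundary M G C)"
    using assms by (auto simp: thin_def not_le)
  have "prob (boundary M G C) \<le> prob (\<Union>C\<in>\<F>. boundary M G C)"
    using C assms by (intro finite_measure_mono sets_UN_boundary) auto
  with C show ?thesis by linarith
qed

text \<open>Take a pair whose value is within \<open>d\<close> of the infimum over all pairs of a
  subclass that is not thin and a finite refinement. Further shrinking and refining stays among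
  these pairs, so it cannot lower the value by \<open>d\<close> or more.\<close>

lemma near_minimal_boundary:
  assumes "\<not> thin M e \<F>" "finite G\<^sub>0" "G\<^sub>0 \<subseteq> events" "0 < d"
  obtains \<G> G where "\<G> \<subseteq> \<F>" "\<not> thin M e \<G>" "G\<^sub>0 \<subseteq> G" "finite G" "G \<subseteq> events"
    "\<And>\<H> H. \<H> \<subseteq> \<G> \<Longrightarrow> \<not> thin M e \<H> \<Longrightarrow> G \<subseteq> H \<Longrightarrow> finite H \<Longrightarrow> H \<subseteq> events \<Longrightarrow>
      prob (\<Union>C\<in>\<G>. boundary M G C) - d < prob (\<Union>C\<in>\<H>. boundary M H C)"
proof -
  define Q where "Q = {(\<G>, G). \<G> \<subseteq> \<F> \<and> \<not> thin M e \<G> \<and> G\<^sub>0 \<subseteq> G \<and> finite G \<and> G \<subseteq> events}"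
  define v where "v = (\<lambda>(\<G>, G). prob (\<Union>C\<in>\<G>. boundary M G C))"
  have "(\<F>, G\<^sub>0) \<in> Q" using assms by (auto simp: Q_def)
  then have ne: "v ` Q \<noteq> {}" by blast
  have bdd: "bdd_below (v ` Q)" by (rule bdd_belowI[of _ 0]) (auto simp: v_def)
  have "Inf (v ` Q) < Inf (v ` Q) + d" using assms by simp
  then obtain p where p: "p \<in> Q" "v p < Inf (v ` Q) + d"
    using cInf_lessD[OF ne] by blast
  have low: "v p - d < v q" if "q \<in> Q" for q
  proof -
    have "Inf (v ` Q) \<le> v q" using that by (intro cInf_lower[OF _ bdd]) auto
    with p show ?thesis by linarith
  qed
  obtain \<G> G where pG: "p = (\<G>, G)" by (cases p)
  show ?thesis
  proof (rule that[of \<G> G])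
    fix \<H> H assume "\<H> \<subseteq> \<G>" "\<not> thin M e \<H>" "G \<subseteq> H" "finite H" "H \<subseteq> events"
    then have "(\<H>, H) \<in> Q" using p pG by (auto simp: Q_def)
    then show "prob (\<Union>C\<in>\<G>. boundary M G C) - d < prob (\<Union>C\<in>\<H>. boundary M H C)"
      using low[of "(\<H>, H)"] by (simp add: v_def pG)
  qed (use p pG in \<open>auto simp: Q_def\<close>)
qed

text \<open>\<open>D\<close> is the intersection of the decreasing unions \<open>V (p n)\<close>
  along near-minimal pairs with tolerance \<open>1 / Suc n\<close>; each union has measure at least
  \<open>e\<close>, hence so does \<open>D\<close>. For a given finite family inside
  \<open>D\<close>, an \<open>n\<close> is used whose tolerance lies below the measures of all its
  members.\<close>

lemma not_thin_cut:
  assumes nt: "\<not> thin M e \<F>" and e: "0 < e" and ev: "\<F> \<subseteq> events"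
  shows "\<exists>D\<in>events. 0 < prob D \<and>
    (\<forall>\<A>. finite \<A> \<longrightarrow> (\<forall>A\<in>\<A>. A \<in> events \<and> A \<subseteq> D \<and> 0 < prob A) \<longrightarrow>
      (\<exists>C\<in>\<F>. \<forall>A\<in>\<A>. cuts M C A))"
proof -
  define V where "V p = (\<Union>C\<in>fst p. boundary M (snd p) C)" for p :: "'a set set \<times> 'a set set"
  \<comment> \<open>A pair consists of a subclass and a generating family. \<open>R n p\<close> says
    that no later pair lowers the measure of \<open>V p\<close> by \<open>1 / Suc n\<close> or
    more.\<close>
  define R where "R n p \<longleftrightarrow> fst p \<subseteq> \<F> \<and> \<not> thin M e (fst p) \<and> finite (snd p) \<and> snd p \<subseteq> events \<and>
      (\<forall>\<H> H. \<H> \<subseteq> fst p \<longrightarrow> \<not> thin M e \<H> \<longrightarrow> snd p \<subseteq> H \<longrightarrow> finite H \<longrightarrow> H \<subseteq> events \<longrightarrow>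
        prob (V p) - 1 / Suc n < prob (V (\<H>, H)))" for n :: nat and p
  have R_D: "fst q \<subseteq> \<F>" "\<not> thin M e (fst q)" "finite (snd q)" "snd q \<subseteq> events" if "R n q" for n q
    using that unfolding R_def by blast+
  have step: "\<exists>q. R n q \<and> fst q \<subseteq> \<G> \<and> G \<subseteq> snd q"
    if st: "\<G> \<subseteq> \<F>" "\<not> thin M e \<G>" "finite G" "G \<subseteq> events" for n \<G> G
  proof -
    obtain \<G>' G' where *: "\<G>' \<subseteq> \<G>" "\<not> thin M e \<G>'" "G \<subseteq> G'" "finite G'" "G' \<subseteq> events"
      "\<And>\<H> H. \<H> \<subseteq> \<G>' \<Longrightarrow> \<not> thin M e \<H> \<Longrightarrow> G' \<subseteq> H \<Longrightarrow> finite H \<Longrightarrow> H \<subseteq> events \<Longrightarrow>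
        prob (\<Union>C\<in>\<G>'. boundary M G' C) - 1 / Suc n < prob (\<Union>C\<in>\<H>. boundary M H C)"
      by (rule near_minimal_boundary[OF st(2-4), of "1 / Suc n"]) (simp, blast)
    have "R n (\<G>', G')"
      unfolding R_def V_def fst_conv snd_conv
      by (intro conjI allI impI order_trans[OF *(1) st(1)] *(2,4,5)) (rule *(6))
    with *(1,3) show ?thesis by (intro exI[of _ "(\<G>', G')"]) simp
  qed
  have "\<exists>p. \<forall>n. R n (p n) \<and> (fst (p (Suc n)) \<subseteq> fst (p n) \<and> snd (p n) \<subseteq> snd (p (Suc n)))"
  proof (rule dependent_nat_choice)
    show "\<exists>q. R 0 q" using step[of \<F> "{}" 0] nt by blast
    fix p n assume "R n p"
    from R_D[OF this] show "\<exists>q. R (Suc n) q \<and> fst q \<subseteq> fst p \<and> snd p \<subseteq> snd q"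
      by (rule step)
  qed
  then obtain p where R: "\<And>n. R n (p n)" and dec: "\<And>n. fst (p (Suc n)) \<subseteq> fst (p n)"
    and inc: "\<And>n. snd (p n) \<subseteq> snd (p (Suc n))" by blast
  note p = R_D[OF R]
  have V_ev: "V (p n) \<in> events" for n
    unfolding V_def using p by (intro sets_UN_boundary)
  have V_dec: "V (p (Suc n)) \<subseteq> V (p n)" for n
    unfolding V_def
  proof (rule UN_mono[OF dec])
    fix C assume "C \<in> fst (p (Suc n))"
    then show "boundary M (snd (p (Suc n))) C \<subseteq> boundary M (snd (p n)) C"
      using p[of "Suc n"] inc[of n] ev by (intro boundary_antimono) auto
  qed
  define D where "D = (\<Inter>n. V (p n))"
  have D: "D \<in> events" unfolding D_def using V_ev by auto
  have "(\<lambda>n. prob (V (p n))) \<longlonglongrightarrow> prob D"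
    unfolding D_def using V_ev V_dec
    by (intro finite_Lim_measure_decseq decseq_SucI) auto
  then have "e \<le> prob D"
  proof (rule LIMSEQ_le_const)
    have "e \<le> prob (V (p n))" for n
      unfolding V_def using p by (intro not_thin_boundary)
    then show "\<exists>N. \<forall>n\<ge>N. e \<le> prob (V (p n))" by blast
  qed
  with e have D_pos: "0 < prob D" by linarith
  show ?thesis
  proof (intro bexI[OF _ D] conjI D_pos allI impI)
    fix \<A> assume fin: "finite \<A>" and all: "\<forall>A\<in>\<A>. A \<in> events \<and> A \<subseteq> D \<and> 0 < prob A"
    then have A: "A \<in> events" "A \<subseteq> D" "0 < prob A" if "A \<in> \<A>" for A using that by auto
    have "\<exists>n::nat. \<forall>A\<in>\<A>. 1 / Suc n < prob A"
    proof -
      \<comment> \<open>The inserted 1 keeps the minimum meaningful when \<open>\<A>\<close> is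
        empty.\<close>
      have "0 < Min (insert 1 (prob ` \<A>))" using fin A(3) by (subst Min_gr_iff) auto
      from reals_Archimedean[OF this] obtain n :: nat
        where n: "1 / Suc n < Min (insert 1 (prob ` \<A>))"
        unfolding inverse_eq_divide ..
      have "1 / Suc n < prob A" if "A \<in> \<A>" for A
      proof (rule less_le_trans[OF n])
        show "Min (insert 1 (prob ` \<A>)) \<le> prob A" using that fin by (intro Min_le) auto
      qed
      then show ?thesis by blast
    qed
    then obtain n :: nat where n: "\<And>A. A \<in> \<A> \<Longrightarrow> 1 / Suc n < prob A" by blast
    \<comment> \<open>Refine by \<open>\<A>\<close> and keep only those members that share one boundary \<open>B\<close>: near-minimality
      makes \<open>B\<close> almost all of \<open>V (p n)\<close>, so \<open>B\<close> meets every \<open>A \<in> \<A>\<close> and contains a cell inside \<open>A\<close>.\<close>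
    define H where "H = snd (p n) \<union> \<A>"
    have H: "finite H" "H \<subseteq> events" using fin A p[of n] by (auto simp: H_def)
    have "fst (p n) \<subseteq> events" using p ev by blast
    then obtain B where B: "\<not> thin M e {C \<in> fst (p n). boundary M H C = B}"
      using not_thin_fiber[OF p(2) _ finite_boundaries[OF H(1)]] by blast
    define \<H> where "\<H> = {C \<in> fst (p n). boundary M H C = B}"
    \<comment> \<open>The empty class is thin, so the chosen fibre has a member and its union of
      boundaries is \<open>B\<close> rather than the empty set.\<close>
    have "thin M e {}" by (auto simp: thin_def)
    with B have "\<H> \<noteq> {}" unfolding \<H>_def by metis
    then obtain C where C: "C \<in> fst (p n)" "boundary M H C = B" by (auto simp: \<H>_def)
    have V_H: "V (\<H>, H) = B" using \<open>\<H> \<noteq> {}\<close> by (auto simp: V_def \<H>_def)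
    have B_ev: "B \<in> events" using C sets_boundary[OF H] by blast
    have large: "prob (V (p n)) - 1 / Suc n < prob B"
    proof -
      have "\<H> \<subseteq> fst (p n)" "\<not> thin M e \<H>" "snd (p n) \<subseteq> H" using B by (auto simp: \<H>_def H_def)
      then have "prob (V (p n)) - 1 / Suc n < prob (V (\<H>, H))"
        using R[of n] H unfolding R_def by blast
      then show ?thesis by (simp only: V_H)
    qed
    have C_ev: "C \<in> events" using C p ev by blast
    have "B \<subseteq> V (p n)"
      using boundary_antimono[OF _ H C_ev, of "snd (p n)"] C by (auto simp: V_def H_def)
    then have small: "prob (V (p n) - B) < 1 / Suc n"
      using large finite_measure_Diff[OF V_ev B_ev] by auto
    \<comment> \<open>As \<open>B\<close> is the boundary of the single set \<open>C\<close>, this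
      one \<open>C\<close> serves all members of \<open>\<A>\<close> at once.\<close>
    show "\<exists>C\<in>\<F>. \<forall>A\<in>\<A>. cuts M C A"
    proof (intro bexI[of _ C] ballI)
      fix A' assume A': "A' \<in> \<A>"
      have "A' \<inter> B \<noteq> {}"
      proof
        assume "A' \<inter> B = {}"
        then have "prob A' \<le> prob (V (p n) - B)"
          using A[OF A'] V_ev B_ev by (intro finite_measure_mono) (auto simp: D_def)
        with small n[OF A'] show False by linarith
      qed
      then obtain x where x: "x \<in> A'" "x \<in> B" by blast
      then have "cuts M C (cell M H x)" using C by (auto simp: boundary_def)
      moreover have "cell M H x \<subseteq> A'" using x A' by (auto simp: cell_def H_def)
      ultimately show "cuts M C A'" using A[OF A'] C_ev sets_cell[OF H] by (auto intro: cuts_mono)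
    qed (use C p in auto)
  qed
qed

text \<open>If \<open>k\<close> members split \<open>D\<close> into \<open>2 ^ k\<close> pieces of
  positive measure, one further member cuts all of these pieces simultaneously, which doubles their
  number.\<close>

lemma not_thin_independent:
  fixes k :: nat
  assumes "\<not> thin M e \<F>" "0 < e" "\<F> \<subseteq> events"
  shows "\<exists>c. (\<forall>i<k. c i \<in> \<F>) \<and>
    (\<forall>J\<subseteq>{..<k}. {x \<in> space M. \<forall>i<k. x \<in> c i \<longleftrightarrow> i \<in> J} \<noteq> {})"
proof -
  obtain D where D: "D \<in> events" "0 < prob D"
    and cut: "\<forall>\<A>. finite \<A> \<longrightarrow> (\<forall>A\<in>\<A>. A \<in> events \<and> A \<subseteq> D \<and> 0 < prob A) \<longrightarrow>
      (\<exists>C\<in>\<F>. \<forall>A\<in>\<A>. cuts M C A)"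
    using not_thin_cut[OF assms] by (elim bexE conjE)
  \<comment> \<open>The induction carries positive measure inside \<open>D\<close>, since only
    pieces of positive measure can be cut again.\<close>
  have "\<exists>c. (\<forall>i<k. c i \<in> \<F>) \<and> (\<forall>J\<subseteq>{..<k}. 0 < prob {x \<in> D. \<forall>i<k. x \<in> c i \<longleftrightarrow> i \<in> J})"
  proof (induction k)
    case 0
    then show ?case using D by auto
  next
    case (Suc k)
    then obtain c where *: "\<forall>i<k. c i \<in> \<F>"
      "\<forall>J\<subseteq>{..<k}. 0 < prob {x \<in> D. \<forall>i<k. x \<in> c i \<longleftrightarrow> i \<in> J}" by (elim exE conjE)
    have c: "c i \<in> \<F>" if "i < k" for i using *(1) that by simp
    have pos: "0 < prob {x \<in> D. \<forall>i<k. x \<in> c i \<longleftrightarrow> i \<in> J}" if "J \<subseteq> {..<k}" for J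
      using *(2) that by simp
    define A where "A J = {x \<in> D. \<forall>i<k. x \<in> c i \<longleftrightarrow> i \<in> J}" for J
    have A_ev: "A J \<in> events" for J
    proof -
      have "{x \<in> space M. x \<in> D \<and> (\<forall>i\<in>{..<k}. x \<in> c i \<longleftrightarrow> i \<in> J)} \<in> events"
      proof (intro sets.sets_Collect_conj sets.sets_Collect_finite_All)
        show "{x \<in> space M. x \<in> D} \<in> events" using D by simp
        fix i assume "i \<in> {..<k}"
        then have [measurable]: "c i \<in> events" using c assms(3) by auto
        show "{x \<in> space M. x \<in> c i \<longleftrightarrow> i \<in> J} \<in> events" by measurable
      qed simp
      also have "{x \<in> space M. x \<in> D \<and> (\<forall>i\<in>{..<k}. x \<in> c i \<longleftrightarrow> i \<in> J)} = A J"
        using sets.sets_into_space[OF D(1)] by (auto simp: A_def)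
      finally show ?thesis .
    qed
    have "\<exists>C\<in>\<F>. \<forall>B\<in>A ` Pow {..<k}. cuts M C B"
    proof (rule cut[THEN spec, THEN mp, THEN mp])
      show "finite (A ` Pow {..<k})" by simp
      show "\<forall>B\<in>A ` Pow {..<k}. B \<in> events \<and> B \<subseteq> D \<and> 0 < prob B"
      proof
        fix B assume "B \<in> A ` Pow {..<k}"
        then obtain J where "J \<subseteq> {..<k}" "B = A J" by blast
        moreover have "A J \<subseteq> D" unfolding A_def by (rule Collect_restrict)
        ultimately show "B \<in> events \<and> B \<subseteq> D \<and> 0 < prob B"
          using A_ev[of J] pos[of J, folded A_def] by (simp only: simp_thms)
      qed
    qed
    then obtain C where C: "C \<in> \<F>" "\<forall>B\<in>A ` Pow {..<k}. cuts M C B" ..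
    show ?case
    proof (intro exI[of _ "c(k := C)"] conjI allI impI)
      fix i assume "i < Suc k"
      then show "(c(k := C)) i \<in> \<F>" using c C by (auto simp: less_Suc_eq)
    next
      fix J assume "J \<subseteq> {..<Suc k}"
      have J: "J - {k} \<subseteq> {..<k}" using \<open>J \<subseteq> {..<Suc k}\<close> by (auto simp: less_Suc_eq)
      have "{x \<in> D. \<forall>i<Suc k. x \<in> (c(k := C)) i \<longleftrightarrow> i \<in> J} =
          (if k \<in> J then A (J - {k}) \<inter> C else A (J - {k}) - C)"
        by (auto simp: A_def less_Suc_eq)
      then show "0 < prob {x \<in> D. \<forall>i<Suc k. x \<in> (c(k := C)) i \<longleftrightarrow> i \<in> J}"
        using C(2)[rule_format, OF imageI[OF PowI[OF J]]]
        by (simp only: cuts_def simp_thms split: if_split)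
    qed
  qed
  then obtain c where c: "\<forall>i<k. c i \<in> \<F>"
    "\<forall>J\<subseteq>{..<k}. 0 < prob {x \<in> D. \<forall>i<k. x \<in> c i \<longleftrightarrow> i \<in> J}" by (elim exE conjE)
  have "{x \<in> space M. \<forall>i<k. x \<in> c i \<longleftrightarrow> i \<in> J} \<noteq> {}" if "J \<subseteq> {..<k}" for J
  proof -
    have "0 < prob {x \<in> D. \<forall>i<k. x \<in> c i \<longleftrightarrow> i \<in> J}" using c(2) that by simp
    then have "{x \<in> D. \<forall>i<k. x \<in> c i \<longleftrightarrow> i \<in> J} \<noteq> {}" by (intro notI) (simp only: measure_empty)
    then show ?thesis using sets.sets_into_space[OF D(1)] by blast
  qed
  with c(1) show ?thesis by (intro exI[of _ c] conjI allI impI) simp_all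
qed

end

section \<open>From independent sets to shattering and finite bracketing\<close>

text \<open>The dual VC bound: index \<open>2 ^ m\<close> independent sets by the subsets of an \<open>m\<close>-element set.\<close>

lemma independent_imp_shatters:
  fixes c :: "nat \<Rightarrow> 'a set"
  assumes "\<And>i. i < 2 ^ m \<Longrightarrow> c i \<in> \<F>"
    and "\<And>J. J \<subseteq> {..<2 ^ m} \<Longrightarrow> {x \<in> \<X>. \<forall>i<2 ^ m. x \<in> c i \<longleftrightarrow> i \<in> J} \<noteq> {}"
  shows "\<exists>D\<subseteq>\<X>. shatters \<F> D \<and> card D = m"
proof -
  have "card {..<(2::nat) ^ m} = card (Pow {..<m})" by (simp add: card_Pow)
  then obtain s where s: "bij_betw s {..<(2::nat) ^ m} (Pow {..<m})"
    using finite_same_card_bij[of "{..<(2::nat) ^ m}" "Pow {..<m}"] by auto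
  \<comment> \<open>The point for \<open>j\<close> is taken from the piece indexed by those
    \<open>i\<close> with \<open>j\<close> in \<open>s i\<close>. Thus \<open>c i\<close> picks out
    exactly the points whose index lies in \<open>s i\<close>, and every subset of the
    \<open>m\<close> points is picked out by some \<open>c i\<close>.\<close>
  have "\<forall>j. \<exists>x. x \<in> \<X> \<and> (\<forall>i<2 ^ m. x \<in> c i \<longleftrightarrow> j \<in> s i)"
  proof
    fix j
    show "\<exists>x. x \<in> \<X> \<and> (\<forall>i<2 ^ m. x \<in> c i \<longleftrightarrow> j \<in> s i)"
      using assms(2)[of "{i. i < 2 ^ m \<and> j \<in> s i}"] by auto
  qed
  then obtain x where x: "\<And>j. x j \<in> \<X>" "\<And>i j. i < 2 ^ m \<Longrightarrow> x j \<in> c i \<longleftrightarrow> j \<in> s i"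
    by (auto dest!: choice)
  have ex: "\<exists>i<2 ^ m. s i = J" if "J \<subseteq> {..<m}" for J
  proof -
    have "J \<in> s ` {..<2 ^ m}" using that bij_betw_imp_surj_on[OF s] by simp
    then show ?thesis by blast
  qed
  \<comment> \<open>The member \<open>c i\<close> with \<open>s i = {j}\<close> contains
    \<open>x j'\<close> only for \<open>j' = j\<close>, so the \<open>m\<close> points are
    distinct.\<close>
  have inj: "inj_on x {..<m}"
  proof (rule inj_onI)
    fix j j' assume j: "j \<in> {..<m}" "j' \<in> {..<m}" "x j = x j'"
    obtain i where i: "i < 2 ^ m" "s i = {j}" using ex[of "{j}"] j by blast
    have "x j \<in> c i" using x(2)[OF i(1)] i(2) by blast
    then have "j' \<in> s i" unfolding j(3) using x(2)[OF i(1)] by blast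
    then show "j = j'" using i(2) by simp
  qed
  define D where "D = x ` {..<m}"
  have fin: "finite D" and card: "card D = m" using inj by (auto simp: D_def card_image)
  have "Pow D \<subseteq> (\<lambda>C. C \<inter> D) ` \<F>"
  proof
    fix E assume "E \<in> Pow D"
    then obtain J where J: "J \<subseteq> {..<m}" "E = x ` J" by (auto simp: D_def subset_image_iff)
    obtain i where i: "i < 2 ^ m" "s i = J" using ex[OF J(1)] by blast
    have "c i \<inter> D = E" using x(2)[OF i(1)] i(2) J by (auto simp: D_def)
    with assms(1)[OF i(1)] show "E \<in> (\<lambda>C. C \<inter> D) ` \<F>" by blast
  qed
  then have "(\<lambda>C. C \<inter> D) ` \<F> = Pow D" by auto
  with fin card have "shatters \<F> D" by (simp add: shatters_def card_Pow)
  moreover have "D \<subseteq> \<X>" using x(1) by (auto simp: D_def)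
  ultimately show ?thesis using card by blast
qed

context prob_space
begin

text \<open>A class that is not thin contains \<open>2 ^ m\<close> independent members for every
  \<open>m\<close>, and these shatter \<open>m\<close> points.\<close>

lemma vc_class_thin:
  assumes "vc_class (space M) \<F>" "\<F> \<subseteq> events" "0 < e"
  shows "thin M e \<F>"
proof (rule ccontr)
  assume nt: "\<not> thin M e \<F>"
  have "enat m \<le> vc_dim (space M) \<F>" for m
  proof -
    obtain c where c: "\<forall>i<(2::nat) ^ m. c i \<in> \<F>"
      "\<forall>J\<subseteq>{..<(2::nat) ^ m}. {x \<in> space M. \<forall>i<(2::nat) ^ m. x \<in> c i \<longleftrightarrow> i \<in> J} \<noteq> {}"
      using not_thin_independent[OF nt assms(3,2), of "2 ^ m"] by (elim exE conjE)
    have "\<exists>D\<subseteq>space M. shatters \<F> D \<and> card D = m"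
      by (rule independent_imp_shatters[of m c]) (use c in \<open>simp_all\<close>)
    then obtain D where D: "D \<subseteq> space M" "shatters \<F> D" "card D = m"
      by (elim exE conjE)
    then show ?thesis unfolding vc_dim_def by (intro SUP_upper2[of D]) auto
  qed
  then have "vc_dim (space M) \<F> = \<infinity>"
    by (metis enat_ord_simps(1) not_infinity_eq not_less_eq_eq order_refl)
  with assms(1) show False by (simp add: vc_class_def)
qed

text \<open>The lower bracket collects the cells lying in \<open>C\<close> up to a null set, the
  upper one the cells meeting \<open>C\<close> in positive measure. Both are unions of cells, so
  there are finitely many brackets; the inclusions hold only up to null sets because a cell with a
  null piece does not count as cut.\<close>

theorem vc_class_finite_bracketing:
  assumes "vc_class (space M) \<F>" "\<F> \<subseteq> events" "0 < e"
  obtains \<B> where "finite \<B>" "\<B> \<subseteq> events"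
    "\<And>C. C \<in> \<F> \<Longrightarrow> \<exists>L\<in>\<B>. \<exists>U\<in>\<B>. prob (L - C) = 0 \<and> prob (C - U) = 0 \<and> prob U \<le> prob L + e"
proof -
  obtain G where G: "finite G" "G \<subseteq> events" and bd: "\<And>C. C \<in> \<F> \<Longrightarrow> prob (boundary M G C) \<le> e"
    using vc_class_thin[OF assms] by (auto simp: thin_def)
  define \<K> where "\<K> = cell M G ` space M"
  have \<K>: "finite \<K>" "\<K> \<subseteq> events" "\<Union>\<K> = space M"
    using finite_cells[OF G(1)] sets_cell[OF G] cell_refl by (auto simp: \<K>_def cell_def)
  show ?thesis
  proof (rule that[of "Union ` Pow \<K>"])
    show "finite (Union ` Pow \<K>)" using \<K> by simp
    show "Union ` Pow \<K> \<subseteq> events" using sets_Union_cells[OF G] by (auto simp: \<K>_def)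
    fix C assume C: "C \<in> \<F>"
    then have C_ev: "C \<in> events" using assms by blast
    define L where "L = \<Union>{A \<in> \<K>. prob (A - C) = 0}"
    define U where "U = \<Union>{A \<in> \<K>. prob (A \<inter> C) \<noteq> 0}"
    have LU: "L \<in> events" "U \<in> events"
      unfolding L_def U_def \<K>_def by (auto intro!: sets_Union_cells[OF G])
    have null: "prob (\<Union>\<A>) = 0" if "finite \<A>" "\<A> \<subseteq> events" "\<And>A. A \<in> \<A> \<Longrightarrow> prob A = 0" for \<A>
    proof -
      have "prob (\<Union>A\<in>\<A>. A) \<le> (\<Sum>A\<in>\<A>. prob A)"
        using that by (intro finite_measure_subadditive_finite) auto
      then show ?thesis using that by (simp add: measure_le_0_iff)
    qed
    have "prob (\<Union>((\<lambda>A. A - C) ` {A \<in> \<K>. prob (A - C) = 0})) = 0"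
      using \<K> C_ev by (intro null) auto
    moreover have "L - C = \<Union>((\<lambda>A. A - C) ` {A \<in> \<K>. prob (A - C) = 0})"
      by (auto simp: L_def)
    ultimately have 1: "prob (L - C) = 0" by simp
    have "prob (\<Union>((\<lambda>A. A \<inter> C) ` {A \<in> \<K>. prob (A \<inter> C) = 0})) = 0"
      using \<K> C_ev by (intro null) auto
    moreover have "prob (C - U) \<le> prob (\<Union>((\<lambda>A. A \<inter> C) ` {A \<in> \<K>. prob (A \<inter> C) = 0}))"
    proof (rule finite_measure_mono)
      show "C - U \<subseteq> \<Union>((\<lambda>A. A \<inter> C) ` {A \<in> \<K>. prob (A \<inter> C) = 0})"
      proof
        fix x assume x: "x \<in> C - U"
        then obtain A where "A \<in> \<K>" "x \<in> A" using sets.sets_into_space[OF C_ev] \<K>(3) by blast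
        with x show "x \<in> \<Union>((\<lambda>A. A \<inter> C) ` {A \<in> \<K>. prob (A \<inter> C) = 0})"
          unfolding U_def by blast
      qed
      show "\<Union>((\<lambda>A. A \<inter> C) ` {A \<in> \<K>. prob (A \<inter> C) = 0}) \<in> events"
        using \<K> C_ev by (intro sets.finite_Union) auto
    qed
    ultimately have 2: "prob (C - U) = 0" by (simp add: measure_le_0_iff)
    \<comment> \<open>A cell counted in \<open>U\<close> but not in \<open>L\<close> has positive
      measure both inside and outside \<open>C\<close>, so it is cut.\<close>
    have "U \<subseteq> L \<union> boundary M G C"
      unfolding boundary_eq_Union by (auto simp: L_def U_def \<K>_def cuts_def zero_less_measure_iff)
    then have "prob U \<le> prob (L \<union> boundary M G C)"
      using LU sets_boundary[OF G] by (intro finite_measure_mono) auto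
    also have "\<dots> \<le> prob L + prob (boundary M G C)"
      using LU sets_boundary[OF G] by (intro measure_Un_le) auto
    finally have 3: "prob U \<le> prob L + e" using bd[OF C] by linarith
    show "\<exists>L\<in>Union ` Pow \<K>. \<exists>U\<in>Union ` Pow \<K>.
        prob (L - C) = 0 \<and> prob (C - U) = 0 \<and> prob U \<le> prob L + e"
      using 1 2 3 unfolding L_def U_def by blast
  qed
qed

end

section \<open>Stationary ergodic processes as the shift on path space\<close>

lemma funpow_shift: "(shift ^^ i) x = (\<lambda>j. x (i + j))"
  by (induction i) (auto simp: shift_def)

lemma measurable_shift: "shift \<in> path_space S \<rightarrow>\<^sub>M path_space S"
  unfolding shift_def[abs_def] path_space_def
  by (intro measurable_PiM_single' measurable_component_singleton)
    (auto simp: space_PiM PiE_iff)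

lemma measurable_path:
  assumes "\<And>i. X i \<in> M \<rightarrow>\<^sub>M S"
  shows "(\<lambda>\<omega> i. X i \<omega>) \<in> M \<rightarrow>\<^sub>M path_space S"
  unfolding path_space_def
  using measurable_space[OF assms] by (intro measurable_PiM_single' assms) auto

lemma measurable_coordinate: "(\<lambda>x. x i) \<in> path_space S \<rightarrow>\<^sub>M S"
  unfolding path_space_def by (rule measurable_component_singleton) simp

text \<open>The image of the path law under \<open>shift\<close> is the law of the process started
  one step later, so stationarity is exactly invariance under \<open>shift\<close>.\<close>

lemma ergodic_map_path_law:
  assumes "prob_space M" "stationary_process M S X" "ergodic_process M S X"
  shows "ergodic_map (path_law M S X) shift"
proof -
  interpret prob_space M by fact
  have X: "\<And>i. X i \<in> M \<rightarrow>\<^sub>M S" using assms by (simp add: stationary_process_def)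
  note path = measurable_path[of X, OF X]
  interpret P: prob_space "path_law M S X"
    unfolding path_law_def by (rule prob_space_distr[OF path])
  have sets: "sets (path_law M S X) = sets (path_space S)" by (simp add: path_law_def)
  note space = sets_eq_imp_space_eq[OF sets]
  show ?thesis
  proof
    show meas: "shift \<in> path_law M S X \<rightarrow>\<^sub>M path_law M S X"
      using measurable_shift measurable_cong_sets[OF sets sets] by blast
    have "distr (path_law M S X) (path_law M S X) shift = distr (path_law M S X) (path_space S) shift"
      by (rule distr_cong) (simp_all add: sets)
    also have "\<dots> = path_law M S (\<lambda>i. X (Suc i))"
      unfolding path_law_def
      by (subst distr_distr[OF measurable_shift path]) (simp add: comp_def shift_def)
    also have "\<dots> = path_law M S X" using assms by (simp add: stationary_process_def)
    finally show "distr (path_law M S X) (path_law M S X) shift = path_law M S X" .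
    show "P.prob A = 0 \<or> P.prob A = 1"
      if "A \<in> P.events" "shift -` A \<inter> space (path_law M S X) = A" for A
      using assms(3) that by (simp add: ergodic_process_def sets space)
  qed
qed

text \<open>Birkhoff's theorem is applied on path space to the indicator of \<open>A\<close> at
  coordinate 0. Its value after \<open>i\<close> shifts is the indicator at \<open>X i\<close>, and
  the almost sure statement is pulled back from the path law to \<open>M\<close>.\<close>

lemma AE_frequency:
  assumes "prob_space M" "stationary_process M S X" "ergodic_process M S X" "A \<in> sets S"
  shows "AE \<omega> in M. (\<lambda>n. (\<Sum>i<n. indicator A (X i \<omega>)) / n) \<longlonglongrightarrow> measure (distr M S (X 0)) A"
proof -
  interpret prob_space M by fact
  interpret P: ergodic_map "path_law M S X" shift by (rule ergodic_map_path_law) fact+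
  have X: "\<And>i. X i \<in> M \<rightarrow>\<^sub>M S" using assms by (simp add: stationary_process_def)
  note path = measurable_path[of X, OF X]
  define f :: "(nat \<Rightarrow> 'b) \<Rightarrow> real" where "f x = indicator A (x 0)" for x
  have f [measurable]: "f \<in> borel_measurable (path_space S)"
    unfolding f_def[abs_def] using assms(4) measurable_coordinate[of 0 S]
    by (intro measurable_compose[OF measurable_coordinate borel_measurable_indicator])
  have "integrable (path_law M S X) f"
    using f by (intro P.integrable_const_bound[where B=1]) (auto simp: f_def path_law_def)
  then have "AE x in path_law M S X.
      (\<lambda>n. birkhoff_sum shift f n x / n) \<longlonglongrightarrow> (\<integral>x. f x \<partial>path_law M S X)"
    by (rule P.birkhoff)
  then have "AE \<omega> in M. (\<lambda>n. birkhoff_sum shift f n (\<lambda>i. X i \<omega>) / n) \<longlonglongrightarrow> (\<integral>x. f x \<partial>path_law M S X)"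
    unfolding path_law_def by (rule AE_distrD[OF path])
  moreover have "(\<integral>x. f x \<partial>path_law M S X) = measure (distr M S (X 0)) A"
  proof -
    have "(\<integral>x. f x \<partial>path_law M S X) = (\<integral>\<omega>. indicator A (X 0 \<omega>) \<partial>M)"
      unfolding path_law_def by (subst integral_distr[OF path f]) (simp add: f_def)
    also have "\<dots> = (\<integral>x. indicator A x \<partial>distr M S (X 0))"
      using assms(4) by (subst integral_distr[OF X]) auto
    finally show ?thesis
      using assms(4) by simp
  qed
  ultimately show ?thesis by (simp add: birkhoff_sum_def f_def funpow_shift)
qed

text \<open>Stationarity speaks of one shift of the whole path; projecting both laws to coordinate
  \<open>i\<close> passes from \<open>X i\<close> to \<open>X (Suc i)\<close>.\<close>

lemma stationary_process_distr_eq: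
  assumes "stationary_process M S X"
  shows "distr M S (X i) = distr M S (X 0)"
proof (induction i)
  case (Suc i)
  have X: "\<And>i. X i \<in> M \<rightarrow>\<^sub>M S" using assms by (simp add: stationary_process_def)
  have *: "distr (path_law M S Y) S (\<lambda>x. x i) = distr M S (Y i)"
    if "\<And>i. Y i \<in> M \<rightarrow>\<^sub>M S" for Y
    unfolding path_law_def
    by (subst distr_distr[OF measurable_coordinate measurable_path[of Y, OF that]]) (simp add: comp_def)
  have "distr M S (X (Suc i)) = distr (path_law M S (\<lambda>i. X (Suc i))) S (\<lambda>x. x i)"
    using *[of "\<lambda>i. X (Suc i)"] X by simp
  also have "\<dots> = distr (path_law M S X) S (\<lambda>x. x i)"
    using assms by (simp add: stationary_process_def)
  also have "\<dots> = distr M S (X 0)" using *[of X] X Suc by simp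
  finally show ?case .
qed simp

text \<open>Brackets contain or are contained in \<open>C\<close> only up to null sets. Almost
  surely the path never visits these, so the inclusions become inequalities between
  frequencies.\<close>

lemma AE_process_notin_null_set:
  assumes "stationary_process M S X" "N \<in> null_sets (distr M S (X 0))"
  shows "AE \<omega> in M. \<forall>i. X i \<omega> \<notin> N"
  unfolding AE_all_countable
proof
  fix i
  have "X i \<in> M \<rightarrow>\<^sub>M S" using assms by (simp add: stationary_process_def)
  moreover have "AE x in distr M S (X i). x \<notin> N"
    using assms(2) unfolding stationary_process_distr_eq[OF assms(1), of i] by (rule AE_not_in)
  ultimately show "AE \<omega> in M. X i \<omega> \<notin> N" by (rule AE_distrD)
qed

text \<open>Here \<open>n\<close> is fixed, so pointwise convergence at the finitely many points \<open>y 0, \<dots>, y (n - 1)\<close>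
  suffices for the frequencies.\<close>

lemma deviation_le_of_separating:
  fixes y :: "nat \<Rightarrow> 'a"
  assumes "prob_space \<mu>" "\<And>k. A k \<in> sets \<mu>" "C \<in> sets \<mu>" "\<And>i. y i \<in> space \<mu>"
    and lim: "\<And>x. x \<in> space \<mu> \<Longrightarrow> (\<lambda>k. indicator (A k) x :: real) \<longlonglongrightarrow> indicator C x"
    and le: "\<And>k. \<bar>(\<Sum>i<n. indicator (A k) (y i)) / n - measure \<mu> (A k)\<bar> \<le> e"
  shows "\<bar>(\<Sum>i<n. indicator C (y i)) / n - measure \<mu> C\<bar> \<le> e"
proof -
  interpret prob_space \<mu> by fact
  have "(\<lambda>k. \<integral>x. indicator (A k) x \<partial>\<mu>) \<longlonglongrightarrow> (\<integral>x. indicator C x \<partial>\<mu> :: real)"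
    by (rule integral_dominated_convergence[where w="\<lambda>_. 1"])
      (use assms(2,3) lim in \<open>auto simp: indicator_def\<close>)
  then have meas: "(\<lambda>k. measure \<mu> (A k)) \<longlonglongrightarrow> measure \<mu> C"
    using assms(2,3) by simp
  have "(\<lambda>k. \<bar>(\<Sum>i<n. indicator (A k) (y i)) / n - measure \<mu> (A k)\<bar>)
      \<longlonglongrightarrow> \<bar>(\<Sum>i<n. indicator C (y i)) / n - measure \<mu> C\<bar>"
    unfolding divide_inverse
    by (intro tendsto_rabs tendsto_diff meas tendsto_mult tendsto_const tendsto_sum lim assms(4))
  then show ?thesis by (rule LIMSEQ_le_const2) (use le in blast)
qed

section \<open>Uniform convergence over the class\<close>

theorem theorem3:
  fixes M :: "'w measure" and S :: "'a measure"
    and \<C> :: "'a set set" and X :: "nat \<Rightarrow> 'w \<Rightarrow> 'a"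
  assumes "prob_space M"
    and "\<C> \<subseteq> sets S"
    and "separable_class (space S) \<C>"
    and "vc_class (space S) \<C>"
    and "stationary_process M S X"
    and "ergodic_process M S X"
  shows "AE \<omega> in M. (\<lambda>n. uniform_deviation M X \<C> n \<omega>) \<longlonglongrightarrow> 0"
proof -
  interpret prob_space M by fact
  have X: "\<And>i. X i \<in> M \<rightarrow>\<^sub>M S" using assms by (simp add: stationary_process_def)
  define \<mu> where "\<mu> = distr M S (X 0)"
  interpret \<mu>: prob_space \<mu> unfolding \<mu>_def by (rule prob_space_distr[OF X])
  have \<mu>_sets [simp]: "sets \<mu> = sets S" "space \<mu> = space S" by (auto simp: \<mu>_def)
  define freq :: "'a set \<Rightarrow> nat \<Rightarrow> 'w \<Rightarrow> real"
    where "freq C n \<omega> = (\<Sum>i<n. indicator C (X i \<omega>)) / n" for C n \<omega>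
  obtain \<C>\<^sub>0 where \<C>\<^sub>0: "\<C>\<^sub>0 \<subseteq> \<C>" "countable \<C>\<^sub>0"
    and sep: "\<And>C. C \<in> \<C> \<Longrightarrow> \<exists>A :: nat \<Rightarrow> 'a set. range A \<subseteq> \<C>\<^sub>0 \<and>
        (\<forall>x\<in>space S. (\<lambda>k. indicator (A k) x :: real) \<longlonglongrightarrow> indicator C x)"
    using assms(3) unfolding separable_class_def by blast
  have ev: "C \<in> sets S" if "C \<in> \<C>" for C using assms(2) that by blast
  \<comment> \<open>One \<open>e\<close> pays for the width of the bracket, the other for the
    deviation of the frequencies of the brackets themselves.\<close>
  have AE_e: "AE \<omega> in M. \<forall>\<^sub>F n in sequentially. \<forall>C\<in>\<C>. \<bar>freq C n \<omega> - \<mu>.prob C\<bar> \<le> 2 * e"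
    if e: "0 < e" for e :: real
  proof -
    obtain \<B> where \<B>: "finite \<B>" "\<B> \<subseteq> \<mu>.events"
      and br: "\<And>C. C \<in> \<C> \<Longrightarrow> \<exists>L\<in>\<B>. \<exists>U\<in>\<B>.
        \<mu>.prob (L - C) = 0 \<and> \<mu>.prob (C - U) = 0 \<and> \<mu>.prob U \<le> \<mu>.prob L + e"
      using \<mu>.vc_class_finite_bracketing[of \<C> e] assms(2,4) e by (metis \<mu>_sets)
    have 1: "AE \<omega> in M. \<forall>B\<in>\<B>. (\<lambda>n. freq B n \<omega>) \<longlonglongrightarrow> \<mu>.prob B"
      unfolding freq_def \<mu>_def using \<B> assms(1,5,6)
      by (intro AE_finite_allI AE_frequency) auto
    \<comment> \<open>Each pair of a member and a bracket has its own exceptional null set.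
      Restricting to the countable \<open>\<C>\<^sub>0\<close> keeps their union null.\<close>
    have 2: "AE \<omega> in M. \<forall>C\<in>\<C>\<^sub>0. \<forall>B\<in>\<B>.
        (\<mu>.prob (B - C) = 0 \<longrightarrow> (\<forall>i. X i \<omega> \<notin> B - C)) \<and> (\<mu>.prob (C - B) = 0 \<longrightarrow> (\<forall>i. X i \<omega> \<notin> C - B))"
    proof (intro AE_ball_countable' \<C>\<^sub>0 countable_finite[OF \<B>(1)])
      fix C B assume "C \<in> \<C>\<^sub>0" "B \<in> \<B>"
      then have CB: "C \<in> sets S" "B \<in> sets S" using ev \<C>\<^sub>0 \<B> by auto
      have *: "AE \<omega> in M. \<mu>.prob N = 0 \<longrightarrow> (\<forall>i. X i \<omega> \<notin> N)" if "N \<in> sets S" for N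
      proof (cases "\<mu>.prob N = 0")
        case True
        then have "N \<in> null_sets \<mu>"
          using that by (intro null_setsI) (auto simp: \<mu>.emeasure_eq_measure)
        then have "AE \<omega> in M. \<forall>i. X i \<omega> \<notin> N"
          unfolding \<mu>_def by (rule AE_process_notin_null_set[OF assms(5)])
        then show ?thesis by eventually_elim blast
      qed simp
      from *[of "B - C"] *[of "C - B"] CB
      show "AE \<omega> in M. (\<mu>.prob (B - C) = 0 \<longrightarrow> (\<forall>i. X i \<omega> \<notin> B - C)) \<and>
          (\<mu>.prob (C - B) = 0 \<longrightarrow> (\<forall>i. X i \<omega> \<notin> C - B))"
        by (intro AE_conjI) auto
    qed
    show ?thesis using 1 2 AE_space
    proof eventually_elim
      case (elim \<omega>)
      have "\<forall>\<^sub>F n in sequentially. \<forall>B\<in>\<B>. \<bar>freq B n \<omega> - \<mu>.prob B\<bar> < e"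
      proof (intro eventually_ball_finite \<B>(1) ballI)
        fix B assume "B \<in> \<B>"
        then have "(\<lambda>n. freq B n \<omega>) \<longlonglongrightarrow> \<mu>.prob B" using elim(1) by blast
        then show "\<forall>\<^sub>F n in sequentially. \<bar>freq B n \<omega> - \<mu>.prob B\<bar> < e"
          using tendstoD[OF _ e] by (fastforce simp: dist_real_def)
      qed
      then show ?case
      proof eventually_elim
        case (elim n)
        have le0: "\<bar>freq C n \<omega> - \<mu>.prob C\<bar> \<le> 2 * e" if C: "C \<in> \<C>\<^sub>0" for C
        proof -
          obtain L U where LU: "L \<in> \<B>" "U \<in> \<B>" "\<mu>.prob (L - C) = 0" "\<mu>.prob (C - U) = 0"
            "\<mu>.prob U \<le> \<mu>.prob L + e"
            using br C \<C>\<^sub>0 by blast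
          have sets: "C \<in> \<mu>.events" "L \<in> \<mu>.events" "U \<in> \<mu>.events"
            using ev C \<C>\<^sub>0 LU \<B> by auto
          have freq_mono: "freq A n \<omega> \<le> freq B n \<omega>" if "\<And>i. X i \<omega> \<notin> A - B" for A B
            unfolding freq_def using that
            by (intro divide_right_mono sum_mono) (auto simp: indicator_def)
          have prob_mono: "\<mu>.prob A \<le> \<mu>.prob B"
            if "A \<in> \<mu>.events" "B \<in> \<mu>.events" "\<mu>.prob (A - B) = 0" for A B
          proof -
            have "\<mu>.prob A \<le> \<mu>.prob (B \<union> (A - B))"
              using that by (intro \<mu>.finite_measure_mono) auto
            also have "\<dots> \<le> \<mu>.prob B + \<mu>.prob (A - B)"
              using that by (intro measure_Un_le) auto
            finally show ?thesis using that by simp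
          qed
          have "freq L n \<omega> \<le> freq C n \<omega>" "freq C n \<omega> \<le> freq U n \<omega>"
            using \<open>\<forall>C\<in>\<C>\<^sub>0. \<forall>B\<in>\<B>. _ C B\<close> C LU by (auto intro!: freq_mono)
          moreover have "\<mu>.prob L \<le> \<mu>.prob C" "\<mu>.prob C \<le> \<mu>.prob U"
            using prob_mono sets LU by auto
          moreover have "\<bar>freq L n \<omega> - \<mu>.prob L\<bar> < e" "\<bar>freq U n \<omega> - \<mu>.prob U\<bar> < e"
            using elim LU by auto
          ultimately show ?thesis using LU(5) by linarith
        qed
        \<comment> \<open>All sets \<open>A k\<close> obey the bound at this same \<open>n\<close>,
          so it passes to their limit \<open>C\<close> and the threshold for \<open>n\<close> stays
          common to the whole class.\<close>
        show ?case
        proof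
          fix C assume C: "C \<in> \<C>"
          obtain A :: "nat \<Rightarrow> 'a set" where A: "range A \<subseteq> \<C>\<^sub>0"
            "\<And>x. x \<in> space S \<Longrightarrow> (\<lambda>k. indicator (A k) x :: real) \<longlonglongrightarrow> indicator C x"
            using sep[OF C] by blast
          show "\<bar>freq C n \<omega> - \<mu>.prob C\<bar> \<le> 2 * e"
            unfolding freq_def
          proof (rule deviation_le_of_separating[OF \<mu>.prob_space_axioms])
            show "A k \<in> \<mu>.events" for k using A(1) \<C>\<^sub>0 ev by auto
            show "C \<in> \<mu>.events" using C ev by simp
            show "X i \<omega> \<in> space \<mu>" for i using measurable_space[OF X] \<open>\<omega> \<in> space M\<close> by simp
            show "(\<lambda>k. indicator (A k) x :: real) \<longlonglongrightarrow> indicator C x" if "x \<in> space \<mu>" for x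
              using A(2) that by simp
            show "\<bar>(\<Sum>i<n. indicator (A k) (X i \<omega>)) / n - \<mu>.prob (A k)\<bar> \<le> 2 * e" for k
              using le0[of "A k"] A(1) by (auto simp: freq_def)
          qed
        qed
      qed
    qed
  qed
  have dev: "uniform_deviation M X \<C> n \<omega> = (SUP C\<in>\<C>. ennreal \<bar>freq C n \<omega> - \<mu>.prob C\<bar>)" for n \<omega>
    unfolding uniform_deviation_def
  proof (rule SUP_cong[OF refl])
    fix C assume "C \<in> \<C>"
    then have "\<mu>.prob C = \<P>(\<omega>' in M. X 0 \<omega>' \<in> C)"
      unfolding \<mu>_def using ev by (subst measure_distr[OF X]) (auto intro!: arg_cong[where f=prob])
    then show "ennreal \<bar>(1 / real n) * (\<Sum>i<n. indicator C (X i \<omega>)) - \<P>(\<omega>' in M. X 0 \<omega>' \<in> C)\<bar> =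
        ennreal \<bar>freq C n \<omega> - \<mu>.prob C\<bar>"
      by (simp add: freq_def)
  qed
  \<comment> \<open>The exceptional set may depend on \<open>e\<close>, so \<open>e\<close> is
    restricted to the sequence \<open>1 / Suc j\<close> before the almost sure statements are
    combined.\<close>
  have "AE \<omega> in M. \<forall>j::nat. \<forall>\<^sub>F n in sequentially. \<forall>C\<in>\<C>.
      \<bar>freq C n \<omega> - \<mu>.prob C\<bar> \<le> 2 * (1 / Suc j)"
    unfolding AE_all_countable by (intro allI AE_e) simp
  then show ?thesis
  proof eventually_elim
    case (elim \<omega>)
    show ?case
    proof (rule order_tendstoI)
      fix a :: ennreal assume "0 < a"
      \<comment> \<open>An intermediate finite \<open>b\<close> turns the weak bound on the supremum
        into a strict one below \<open>a\<close>, and covers an infinite \<open>a\<close>.\<close>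
      then obtain b where b: "0 < b" "b < a" using dense by blast
      then obtain r where r: "b = ennreal r" "0 < r" by (cases b) auto
      obtain j :: nat where j: "1 / Suc j < r / 2"
        using reals_Archimedean[of "r / 2"] r by (auto simp: inverse_eq_divide)
      from elim have "\<forall>\<^sub>F n in sequentially. \<forall>C\<in>\<C>. \<bar>freq C n \<omega> - \<mu>.prob C\<bar> \<le> 2 * (1 / Suc j)"
        by blast
      then show "\<forall>\<^sub>F n in sequentially. uniform_deviation M X \<C> n \<omega> < a"
      proof eventually_elim
        case (elim n)
        have "uniform_deviation M X \<C> n \<omega> \<le> b"
          unfolding dev r(1) using elim j by (intro SUP_least ennreal_leI) force
        with b(2) show ?case by (rule le_less_trans[rotated])
      qed
    qed simp
  qed
qed

end
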